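(* Let $\mathbb{S}_1,\mathbb{S}_2,\mathbb{S}_3$ be Borel subsets of Polish spaces, let $P$ be a stochastic kernel on $\mathbb{S}_1\times\mathbb{S}_2$ given $\mathbb{S}_3$, let $P'(C|s_3):=P(\mathbb{S}_1\times C|s_3)$ for $C\in\mathcal{B}(\mathbb{S}_2)$, $s_3\in\mathbb{S}_3$, and let $H$ be a stochastic kernel on $\mathbb{S}_1$ given $\mathbb{S}_2\times\mathbb{S}_3$ such that $$P(B\times C|s_3)=\int_C H(B|s_2,s_3)\,P'(ds_2|s_3)\quad\text{for all } B\in\mathcal{B}(\mathbb{S}_1),\ C\in\mathcal{B}(\mathbb{S}_2),\ s_3\in\mathbb{S}_3 .$$ Let $s_3\in\mathbb{S}_3$, and suppose the topology on $\mathbb{S}_1$ has a countable base $\tau_b$ such that: (i) $\mathbb{S}_1\in\tau_b$; (ii) for each finite intersection $\mathcal{O}=\bigcap_{i=1}^N\mathcal{O}^i$ of sets $\mathcal{O}^i\in\tau_b$, $i=1,\ldots,N$, the family of functions $\mathcal{P}_{\mathcal{O}}=\{s\mapsto P(\mathcal{O}\times C|s): C \text{ open in } \mathbb{S}_2\}$ on $\mathbb{S}_3$ is equicontinuous at the point $s_3$. Then for any sequence $\{s_3^{(n)}\}_{n=1,2,\ldots}$ from $\mathbb{S}_3$ converging to $s_3$ there exist a subsequence $\{n_k\}_{k=1,2,\ldots}$ and a set $C^*\in\mathcal{B}(\mathbb{S}_2)$ such that $P'(C^*|s_3)=1$ and, for all $s_2\in C^*$, $H(\,\cdot\,|s_2,s_3^{(n_k)})$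 converges weakly to $H(\,\cdot\,|s_2,s_3)$ as $k\to\infty$.
   Context: $\mathcal{B}(\mathbb{S})$ is the Borel $\sigma$-field of a metric space $\mathbb{S}$. A stochastic kernel $R(ds_1|s_2)$ on $\mathbb{S}_1$ given $\mathbb{S}_2$ is a map $R:\mathcal{B}(\mathbb{S}_1)\times\mathbb{S}_2\to[0,1]$ such that $R(\,\cdot\,|s_2)$ is a probability measure on $\mathbb{S}_1$ for each $s_2\in\mathbb{S}_2$ and $R(B|\,\cdot\,)$ is Borel measurable on $\mathbb{S}_2$ for each $B\in\mathcal{B}(\mathbb{S}_1)$. A family $\mathcal{A}_0$ of real-valued functions on a metric space $\mathbb{S}$ is equicontinuous at a point $s\in\mathbb{S}$ if $\sup_{f\in\mathcal{A}_0}|f(s')-f(s)|\to0$ as $s'\to s$. A kernel $H$ as in the statement always exists, and for each $s_3$ it is unique up to a $P'(\,\cdot\,|s_3)$-null set of $s_2$. Borel subsets of Polish (complete separable metric) spaces are considered as metric spaces with the induced metric. *)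

theory Defs
  imports "HOL-Probability.Probability"
begin

abbreviation borel_on :: "'a::topological_space set \<Rightarrow> 'a measure" where
  "borel_on S \<equiv> restrict_space borel S"

text \<open>
  A kernel \<open>R(ds1 | s2)\<close> is a function \<open>R\<close> from points of \<open>S2\<close> to measures; its values outside \<open>S2\<close>
  are irrelevant.
\<close>

definition stochastic_kernel ::
    "'a::topological_space set \<Rightarrow> 'b::topological_space set \<Rightarrow> ('b \<Rightarrow> 'a measure) \<Rightarrow> bool" where
  "stochastic_kernel S1 S2 R \<longleftrightarrow>
     (\<forall>s2\<in>S2. prob_space (R s2) \<and> sets (R s2) = sets (borel_on S1)) \<and>
     (\<forall>B\<in>sets (borel_on S1). (\<lambda>s2. measure (R s2) B) \<in> borel_measurable (borel_on S2))"

lemma stochastic_kernel_iff_measurable_prob_algebra: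
  "stochastic_kernel S1 S2 R \<longleftrightarrow> R \<in> borel_on S2 \<rightarrow>\<^sub>M prob_algebra (borel_on S1)"
proof
  assume R: "stochastic_kernel S1 S2 R"
  show "R \<in> borel_on S2 \<rightarrow>\<^sub>M prob_algebra (borel_on S1)"
  proof (intro measurable_prob_algebraI measurable_subprob_algebra)
    fix a assume a: "a \<in> space (borel_on S2)"
    then show "prob_space (R a)" "sets (R a) = sets (borel_on S1)"
      using R by (auto simp: stochastic_kernel_def space_restrict_space)
    then show "subprob_space (R a)"
      by (simp add: prob_space_imp_subprob_space)
  next
    fix A assume A: "A \<in> sets (borel_on S1)"
    have "(\<lambda>a. ennreal (measure (R a) A)) \<in> borel_measurable (borel_on S2)"
      using R A by (intro measurable_compose[OF _ measurable_ennreal]) (auto simp: stochastic_kernel_def)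
    also have "?this \<longleftrightarrow> (\<lambda>a. emeasure (R a) A) \<in> borel_measurable (borel_on S2)"
      using R by (intro measurable_cong)
        (auto simp: stochastic_kernel_def space_restrict_space
              finite_measure.emeasure_eq_measure prob_space.finite_measure)
    finally show "(\<lambda>a. emeasure (R a) A) \<in> borel_measurable (borel_on S2)" .
  qed
next
  assume R: "R \<in> borel_on S2 \<rightarrow>\<^sub>M prob_algebra (borel_on S1)"
  have "R s \<in> space (prob_algebra (borel_on S1))" if "s \<in> S2" for s
    using measurable_space[OF R] that by (simp add: space_restrict_space)
  then show "stochastic_kernel S1 S2 R"
    using measurable_compose[OF R measurable_measure_prob_algebra]
    by (auto simp: stochastic_kernel_def space_prob_algebra)
qed

definition marginal_kernel ::
    "'b::topological_space set \<Rightarrow> ('c \<Rightarrow> ('a::topological_space \<times> 'b) measure) \<Rightarrow> 'c \<Rightarrow> 'b measure" where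
  "marginal_kernel S2 P s3 = distr (P s3) (borel_on S2) snd"

lemma emeasure_marginal_kernel:
  assumes P: "stochastic_kernel (S1 \<times> S2) S3 P"
    and "s3 \<in> S3" "C \<in> sets (borel_on S2)"
  shows "emeasure (marginal_kernel S2 P s3) C = emeasure (P s3) (S1 \<times> C)"
proof -
  have sets: "sets (P s3) = sets (borel_on (S1 \<times> S2))"
    using assms by (auto simp: stochastic_kernel_def)
  then have sp: "space (P s3) = S1 \<times> S2"
    using sets_eq_imp_space_eq[OF sets] by (simp add: space_restrict_space)
  have "(snd :: 'a \<times> 'b \<Rightarrow> 'b) \<in> borel \<rightarrow>\<^sub>M borel"
    by (intro borel_measurable_continuous_onI continuous_on_snd continuous_on_id)
  then have "snd \<in> borel_on (S1 \<times> S2) \<rightarrow>\<^sub>M borel_on S2"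
    by (intro measurable_restrict_space3) auto
  then have "snd \<in> P s3 \<rightarrow>\<^sub>M borel_on S2"
    using measurable_cong_sets[OF sets refl] by blast
  moreover have "snd -` C \<inter> space (P s3) = S1 \<times> C"
    using sets.sets_into_space[OF assms(3)] by (auto simp: sp space_restrict_space)
  ultimately show ?thesis
    using assms(3) by (simp add: marginal_kernel_def emeasure_distr)
qed

text \<open>The supremum is taken in \<^typ>\<open>ennreal\<close>, so that an unbounded family has supremum \<open>\<infinity>\<close>.\<close>

definition equicontinuous_at :: "'c::metric_space set \<Rightarrow> ('c \<Rightarrow> real) set \<Rightarrow> 'c \<Rightarrow> bool" where
  "equicontinuous_at S F s \<longleftrightarrow>
     ((\<lambda>s'. SUP f\<in>F. ennreal \<bar>f s' - f s\<bar>) \<longlongrightarrow> 0) (at s within S)"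

definition weakly_converges_on ::
    "'a::topological_space set \<Rightarrow> (nat \<Rightarrow> 'a measure) \<Rightarrow> 'a measure \<Rightarrow> bool" where
  "weakly_converges_on S M N \<longleftrightarrow>
     (\<forall>f :: 'a \<Rightarrow> real. continuous_on S f \<and> bounded (f ` S) \<longrightarrow>
        (\<lambda>n. \<integral>x. f x \<partial>M n) \<longlonglongrightarrow> (\<integral>x. f x \<partial>N))"

end

theory Submission
  imports Defs "HOL-Library.Diagonal_Subsequence"
begin

text \<open>
  Fix a finite intersection \<open>X\<close> of sets from the base and put \<open>f\<^sub>n(x) = H(X | x, s\<^sub>n)\<close>,
  \<open>f(x) = H(X | x, s\<^sub>3)\<close>, \<open>\<mu>\<^sub>n = P'( . | s\<^sub>n)\<close> and \<open>\<mu> = P'( . | s\<^sub>3)\<close>. Then \<open>P(X \<times> C | s\<^sub>n)\<close> is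
  \<open>\<integral>\<^sub>C f\<^sub>n d\<mu>\<^sub>n\<close>, and equicontinuity says that it converges to \<open>\<integral>\<^sub>C f d\<mu>\<close> uniformly over open sets
  \<open>C\<close>. Because finite Borel measures are outer regular, the convergence is uniform over all
  Borel sets \<open>C\<close>. The case \<open>X = S1\<close> says that \<open>\<mu>\<^sub>n\<close> tends to \<open>\<mu>\<close> in total variation, hence
  \<open>\<integral>\<^sub>C f\<^sub>n d\<mu>\<close> tends to \<open>\<integral>\<^sub>C f d\<mu>\<close> uniformly as well, and the choices \<open>C = {f < f\<^sub>n}\<close> and its complement
  show that \<open>f\<^sub>n \<longrightarrow> f\<close> in \<open>L\<^sup>1(\<mu>)\<close> (\<open>integral_abs_diff_le_if_openin\<close>).

  There are only countably many such \<open>X\<close>, so along one subsequence \<open>f\<^sub>n \<longrightarrow> f\<close> holds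
  \<open>\<mu>\<close>-almost everywhere for all of them simultaneously (\<open>AE_tendsto_subseq_countable\<close>). At every point
  outside the exceptional null set the measures \<open>H( . | x, s\<^sub>n)\<close> along the subsequence thus converge
  on an intersection-stable family containing a base. By inclusion and exclusion they converge on finite
  unions, so on open sets the lower limit is at least the limit measure
  (\<open>emeasure_countable_Union_le_liminf\<close>). By the portmanteau theorem this is enough for weak
  convergence (\<open>weakly_converges_on_if_liminf_open\<close>).
\<close>

section \<open>Integrals through level sets\<close>

text \<open>
  Both sides are the measure of the region under the graph of \<open>g\<close>, computed by slicing it in the two
  directions. The formula reduces comparisons of integrals to comparisons of measures of the level
  sets \<open>{t < g}\<close>; it does so both for two measures that are close to each other and
  for the limits in the portmanteau argument.
\<close>

lemma nn_integral_layer_cake: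
  fixes g :: "'a \<Rightarrow> real"
  assumes "sigma_finite_measure M" and g[measurable]: "g \<in> borel_measurable M"
    and bnd: "\<And>x. x \<in> space M \<Longrightarrow> 0 \<le> g x \<and> g x \<le> b"
  shows "(\<integral>\<^sup>+x. g x \<partial>M) = (\<integral>\<^sup>+t\<in>{0..b}. emeasure M {x\<in>space M. t < g x} \<partial>lborel)"
proof -
  interpret M: sigma_finite_measure M by fact
  interpret pair_sigma_finite M lborel ..
  define k :: "'a \<Rightarrow> real \<Rightarrow> ennreal" where "k x t = indicator {t. 0 \<le> t \<and> t \<le> b \<and> t < g x} t" for x t
  have k[measurable]: "case_prod k \<in> borel_measurable (M \<Otimes>\<^sub>M lborel)"
    unfolding k_def indicator_def by measurable
  have "(\<integral>\<^sup>+x. g x \<partial>M) = (\<integral>\<^sup>+x. (\<integral>\<^sup>+t. k x t \<partial>lborel) \<partial>M)"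
  proof (rule nn_integral_cong)
    fix x assume "x \<in> space M"
    with bnd have "{t. 0 \<le> t \<and> t \<le> b \<and> t < g x} = {0..<g x}" "0 \<le> g x" by force+
    then show "ennreal (g x) = (\<integral>\<^sup>+t. k x t \<partial>lborel)"
      by (simp add: k_def nn_integral_indicator)
  qed
  also have "\<dots> = (\<integral>\<^sup>+t. (\<integral>\<^sup>+x. k x t \<partial>M) \<partial>lborel)"
    by (rule Fubini'[symmetric]) (rule k)
  also have "\<dots> = (\<integral>\<^sup>+t\<in>{0..b}. emeasure M {x\<in>space M. t < g x} \<partial>lborel)"
  proof (rule nn_integral_cong)
    fix t
    have "(\<integral>\<^sup>+x. k x t \<partial>M) = (\<integral>\<^sup>+x. indicator {0..b} t * indicator {x\<in>space M. t < g x} x \<partial>M)"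
      by (intro nn_integral_cong) (auto simp: k_def indicator_def)
    also have "\<dots> = emeasure M {x\<in>space M. t < g x} * indicator {0..b} t"
      by (subst nn_integral_cmult) (auto simp: nn_integral_indicator mult.commute)
    finally show "(\<integral>\<^sup>+x. k x t \<partial>M) = emeasure M {x\<in>space M. t < g x} * indicator {0..b} t" .
  qed
  finally show ?thesis .
qed

text \<open>
  The level sets of \<open>g\<close> are indexed by levels in \<open>[0, 1]\<close>, so the error \<open>e\<close> of the measures is
  integrated over an interval of length one and does not grow.
\<close>

lemma integral_le_add_if_measure_le_add:
  fixes g :: "'a \<Rightarrow> real"
  assumes M: "finite_measure M" and N: "finite_measure N" and sets: "sets M = sets N"
    and le: "\<And>A. A \<in> sets N \<Longrightarrow> measure M A \<le> measure N A + e" and e: "0 \<le> e"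
    and g: "g \<in> borel_measurable N" "\<And>x. x \<in> space N \<Longrightarrow> 0 \<le> g x \<and> g x \<le> 1"
  shows "(\<integral>x. g x \<partial>M) \<le> (\<integral>x. g x \<partial>N) + e"
proof -
  interpret M: finite_measure M by fact
  interpret N: finite_measure N by fact
  have sp: "space M = space N" by (rule sets_eq_imp_space_eq) fact
  have gM: "g \<in> borel_measurable M"
    using g(1) measurable_cong_sets[OF sets refl] by blast
  note [measurable] = g(1)
  have "(\<integral>\<^sup>+x. g x \<partial>M) = (\<integral>\<^sup>+t\<in>{0..1}. emeasure M {x\<in>space N. t < g x} \<partial>lborel)"
    using nn_integral_layer_cake[OF _ gM, of 1] g(2) by (simp add: sp M.sigma_finite_measure_axioms)
  also have "\<dots> \<le> (\<integral>\<^sup>+t\<in>{0..1}. (emeasure N {x\<in>space N. t < g x} + ennreal e) \<partial>lborel)"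
    using le e
    by (intro nn_integral_mono mult_right_mono)
      (auto simp: M.emeasure_eq_measure N.emeasure_eq_measure simp flip: ennreal_plus intro!: ennreal_leI)
  also have "\<dots> = (\<integral>\<^sup>+t\<in>{0..1::real}. emeasure N {x\<in>space N. t < g x} \<partial>lborel) + ennreal e"
    by (simp add: distrib_right nn_integral_add nn_integral_cmult)
  also have "(\<integral>\<^sup>+t\<in>{0..1}. emeasure N {x\<in>space N. t < g x} \<partial>lborel) = (\<integral>\<^sup>+x. g x \<partial>N)"
    using nn_integral_layer_cake[OF _ g(1), of 1] g(2) by (simp add: N.sigma_finite_measure_axioms)
  finally have "(\<integral>\<^sup>+x. g x \<partial>M) \<le> (\<integral>\<^sup>+x. g x \<partial>N) + ennreal e" .
  moreover have "integrable M g" "integrable N g"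
    using g gM by (auto intro!: M.integrable_const_bound[of _ 1] N.integrable_const_bound[of _ 1] simp: sp)
  then have "(\<integral>\<^sup>+x. g x \<partial>M) = ennreal (\<integral>x. g x \<partial>M)" "(\<integral>\<^sup>+x. g x \<partial>N) = ennreal (\<integral>x. g x \<partial>N)"
    using g(2) by (auto intro!: nn_integral_eq_integral simp: sp)
  ultimately have "ennreal (\<integral>x. g x \<partial>M) \<le> ennreal ((\<integral>x. g x \<partial>N) + e)"
    using g(2) e by (simp add: ennreal_plus integral_nonneg_AE)
  then show ?thesis
    using g(2) e by (subst (asm) ennreal_le_iff) (auto intro!: add_nonneg_nonneg integral_nonneg_AE)
qed

section \<open>From open sets to all Borel sets\<close>

text \<open>
  The subspace \<open>S\<close> need not be Polish, but the image of \<open>M\<close> under the inclusion of \<open>S\<close> is a finite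
  Borel measure on the ambient Polish space, hence outer regular. Intersecting with \<open>S\<close> brings the
  approximating open sets back.
\<close>

lemma outer_regular_borel_on:
  fixes M :: "'a::polish_space measure"
  assumes M: "finite_measure M" "sets M = sets (borel_on S)" and A: "A \<in> sets M" and d: "0 < d"
  shows "\<exists>U. openin (top_of_set S) U \<and> A \<subseteq> U \<and> measure M U \<le> measure M A + d"
proof -
  interpret finite_measure M by fact
  have sp: "space M = S"
    using sets_eq_imp_space_eq[OF M(2)] by (simp add: space_restrict_space)
  have id: "(\<lambda>x. x) \<in> M \<rightarrow>\<^sub>M borel"
    unfolding measurable_cong_sets[OF M(2) refl] by (intro measurable_restrict_space1) auto
  define M' where "M' = distr M borel (\<lambda>x. x)"
  have M'_eq: "emeasure M' B = emeasure M (S \<inter> B)" if "B \<in> sets borel" for B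
    using that by (simp add: M'_def emeasure_distr[OF id] sp Int_commute)
  obtain B where B: "B \<in> sets borel" "A = S \<inter> B"
    using A by (auto simp: M(2) sets_restrict_space)
  have "emeasure M' B = (INF U \<in> {U. B \<subseteq> U \<and> open U}. emeasure M' U)"
    using finite_measure.emeasure_finite[OF finite_measure_distr[OF id]] B(1)
    by (intro outer_regular) (auto simp: M'_def)
  moreover have "emeasure M' B < emeasure M' B + ennreal d"
    using d by (simp add: M'_eq[OF B(1)] emeasure_eq_measure ennreal_less_iff flip: ennreal_plus)
  ultimately obtain U where U: "B \<subseteq> U" "open U" "emeasure M' U < emeasure M' B + ennreal d"
    by (auto simp: INF_less_iff)
  then have "measure M (S \<inter> U) < measure M A + d"
    using d by (simp add: M'_eq B emeasure_eq_measure ennreal_less_iff flip: ennreal_plus)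
  then show ?thesis
    using U(1,2) B(2) by (intro exI[of _ "S \<inter> U"]) auto
qed

text \<open>
  An open superset of \<open>A\<close> that is nearly optimal for \<open>N\<close> bounds the measure of \<open>A\<close> under \<open>M\<close> by
  monotonicity. Exchanging the roles turns a bound of \<open>\<bar>M U - N U\<bar>\<close> for open
  sets \<open>U\<close> into one for all Borel sets.
\<close>

lemma measure_le_add_if_openin:
  fixes M N :: "'a::polish_space measure"
  assumes M: "finite_measure M" "sets M = sets (borel_on S)"
    and N: "finite_measure N" "sets N = sets (borel_on S)"
    and le: "\<And>U. openin (top_of_set S) U \<Longrightarrow> measure M U \<le> measure N U + e"
    and A: "A \<in> sets N"
  shows "measure M A \<le> measure N A + e"
proof (rule field_le_epsilon)
  interpret M: finite_measure M by fact
  fix d :: real assume "0 < d"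
  then obtain U where U: "openin (top_of_set S) U" "A \<subseteq> U" "measure N U \<le> measure N A + d"
    using outer_regular_borel_on[OF N A] by blast
  have "U \<in> sets M"
    using U(1) by (auto simp: M(2) openin_open sets_restrict_space)
  then have "measure M A \<le> measure M U"
    using U(2) by (intro M.finite_measure_mono)
  then show "measure M A \<le> measure N A + e + d"
    using le[OF U(1)] U(3) by linarith
qed

section \<open>Mean convergence of densities\<close>

lemma measure_density_eq_integral:
  fixes f :: "'a \<Rightarrow> real"
  assumes f: "f \<in> borel_measurable M" "\<And>x. x \<in> space M \<Longrightarrow> 0 \<le> f x" and A: "A \<in> sets M"
  shows "measure (density M f) A = (\<integral>x. indicator A x * f x \<partial>M)"
proof -
  have "measure (density M f) A = (\<integral>x. indicator A x \<partial>density M f)"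
    using A sets.sets_into_space[OF A] by (simp add: Int_absorb2)
  also have "\<dots> = (\<integral>x. f x *\<^sub>R indicator A x \<partial>M)"
    using f A by (intro integral_density) auto
  finally show ?thesis by (simp add: mult.commute)
qed

lemma finite_measure_density_le_1:
  fixes f :: "'a \<Rightarrow> real"
  assumes "finite_measure M" "f \<in> borel_measurable M" "\<And>x. x \<in> space M \<Longrightarrow> f x \<le> 1"
  shows "finite_measure (density M f)"
proof
  interpret finite_measure M by fact
  have "emeasure (density M f) (space (density M f)) \<le> (\<integral>\<^sup>+x. 1 \<partial>M)"
    using assms by (simp only: space_density, subst emeasure_density) (auto intro!: nn_integral_mono simp: indicator_def simp del: nn_integral_const)
  also have "\<dots> < \<infinity>" by (simp add: less_top[symmetric])
  finally show "emeasure (density M f) (space (density M f)) \<noteq> \<infinity>" by simp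
qed

text \<open>
  The form in which equicontinuity is exploited: a bound for open sets, both for the measures and
  for their weighted versions, becomes an \<open>L\<^sup>1\<close> bound for the weights. By regularity the bounds
  hold for all Borel sets \<open>A\<close>. Replacing \<open>N\<close> by \<open>M\<close> in \<open>\<integral>\<^sub>A g dN\<close> costs another \<open>e\<close>, hence
  \<open>\<integral>\<^sub>A g dM\<close> and \<open>\<integral>\<^sub>A f dM\<close> differ by at most \<open>2e\<close>. Taking for \<open>A\<close> the set \<open>{f < g}\<close> and its
  complement gives the \<open>L\<^sup>1\<close> norm.
\<close>

lemma integral_abs_diff_le_if_openin:
  fixes M N :: "'a::polish_space measure" and f g :: "'a \<Rightarrow> real"
  assumes M: "finite_measure M" "sets M = sets (borel_on S)"
    and N: "finite_measure N" "sets N = sets (borel_on S)"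
    and f: "f \<in> borel_measurable M" "\<And>x. x \<in> S \<Longrightarrow> 0 \<le> f x \<and> f x \<le> 1"
    and g: "g \<in> borel_measurable M" "\<And>x. x \<in> S \<Longrightarrow> 0 \<le> g x \<and> g x \<le> 1"
    and MN: "\<And>U. openin (top_of_set S) U \<Longrightarrow> \<bar>measure N U - measure M U\<bar> \<le> e"
    and gf: "\<And>U. openin (top_of_set S) U \<Longrightarrow>
               \<bar>measure (density N g) U - measure (density M f) U\<bar> \<le> e"
  shows "(\<integral>x. \<bar>g x - f x\<bar> \<partial>M) \<le> 4 * e"
proof -
  interpret M: finite_measure M by fact
  interpret N: finite_measure N by fact
  have e: "0 \<le> e" using MN[of "{}"] by simp
  have sp: "space M = S" "space N = S"
    using sets_eq_imp_space_eq[OF M(2)] sets_eq_imp_space_eq[OF N(2)] by (auto simp: space_restrict_space)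
  have sets: "sets N = sets M" by (simp add: M N)
  have gN: "g \<in> borel_measurable N"
    using g(1) measurable_cong_sets[OF sets refl] by blast
  note [measurable] = f(1) g(1)
  have int: "integrable M f" "integrable M g"
    using f g by (auto intro!: M.integrable_const_bound[of _ 1] simp: sp)
  have D: "finite_measure (density M f)" "finite_measure (density N g)"
    using f g gN M N by (auto intro!: finite_measure_density_le_1 simp: sp)
  have NM: "measure N A \<le> measure M A + e" if "A \<in> sets M" for A
  proof (rule measure_le_add_if_openin[OF N M _ that])
    show "measure N U \<le> measure M U + e" if "openin (top_of_set S) U" for U using MN[OF that] by linarith
  qed
  have MN': "measure M A \<le> measure N A + e" if "A \<in> sets N" for A
  proof (rule measure_le_add_if_openin[OF M N _ that])
    show "measure M U \<le> measure N U + e" if "openin (top_of_set S) U" for U using MN[OF that] by linarith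
  qed
  have upper: "(\<integral>x. indicator A x * g x \<partial>M) \<le> (\<integral>x. indicator A x * f x \<partial>M) + 2 * e"
    if A: "A \<in> sets M" for A
  proof -
    have "(\<integral>x. indicator A x * g x \<partial>M) \<le> (\<integral>x. indicator A x * g x \<partial>N) + e"
      using MN' e A gN g(2)
      by (intro integral_le_add_if_measure_le_add[OF M(1) N(1)])
        (auto simp: sets sp mult_le_one intro!: borel_measurable_times borel_measurable_indicator)
    also have "(\<integral>x. indicator A x * g x \<partial>N) = measure (density N g) A"
      using gN g(2) A by (subst measure_density_eq_integral) (auto simp: sp sets)
    also have "\<dots> \<le> measure (density M f) A + e"
    proof (rule measure_le_add_if_openin[OF D(2) _ D(1)])
      show "measure (density N g) U \<le> measure (density M f) U + e" if "openin (top_of_set S) U" for U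
        using gf[OF that] by linarith
    qed (use A M N in auto)
    also have "measure (density M f) A = (\<integral>x. indicator A x * f x \<partial>M)"
      using f A by (subst measure_density_eq_integral) (auto simp: sp)
    finally show ?thesis by simp
  qed
  have lower: "(\<integral>x. indicator A x * f x \<partial>M) \<le> (\<integral>x. indicator A x * g x \<partial>M) + 2 * e"
    if A: "A \<in> sets M" for A
  proof -
    have "(\<integral>x. indicator A x * f x \<partial>M) = measure (density M f) A"
      using f A by (subst measure_density_eq_integral) (auto simp: sp)
    also have "\<dots> \<le> measure (density N g) A + e"
    proof (rule measure_le_add_if_openin[OF D(1) _ D(2)])
      show "measure (density M f) U \<le> measure (density N g) U + e" if "openin (top_of_set S) U" for U
        using gf[OF that] by linarith
    qed (use A M N in auto)
    also have "measure (density N g) A = (\<integral>x. indicator A x * g x \<partial>N)"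
      using gN g(2) A by (subst measure_density_eq_integral) (auto simp: sp sets)
    also have "\<dots> \<le> (\<integral>x. indicator A x * g x \<partial>M) + e"
      using NM e A g
      by (intro integral_le_add_if_measure_le_add[OF N(1) M(1)])
        (auto simp: sets sp mult_le_one intro!: borel_measurable_times borel_measurable_indicator)
    finally show ?thesis by simp
  qed
  define D where "D = {x\<in>space M. f x < g x}"
  have D: "D \<in> sets M" "space M - D \<in> sets M" unfolding D_def by measurable
  have intI: "integrable M (\<lambda>x. indicator A x * f x)" "integrable M (\<lambda>x. indicator A x * g x)"
    if "A \<in> sets M" for A
    using that int by (auto intro: integrable_mult_indicator[where 'b = real, simplified])
  have "(\<integral>x. \<bar>g x - f x\<bar> \<partial>M) = (\<integral>x. (indicator D x * g x - indicator D x * f x)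
      + (indicator (space M - D) x * f x - indicator (space M - D) x * g x) \<partial>M)"
    by (intro Bochner_Integration.integral_cong) (auto simp: D_def indicator_def)
  also have "\<dots> = ((\<integral>x. indicator D x * g x \<partial>M) - (\<integral>x. indicator D x * f x \<partial>M))
      + ((\<integral>x. indicator (space M - D) x * f x \<partial>M) - (\<integral>x. indicator (space M - D) x * g x \<partial>M))"
    using intI[OF D(1)] intI[OF D(2)] by simp
  also have "\<dots> \<le> 4 * e"
    using upper[OF D(1)] lower[OF D(2)] by linarith
  finally show ?thesis .
qed

text \<open>
  For one index, \<open>L\<^sup>1\<close> convergence yields an almost everywhere convergent subsequence. A diagonal
  sequence works for all indices at once, because almost everywhere convergence passes to further
  subsequences and does not depend on finitely many terms.
\<close>

lemma AE_tendsto_subseq_countable: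
  fixes u :: "'i \<Rightarrow> nat \<Rightarrow> 'a \<Rightarrow> real"
  assumes I: "countable I"
    and int: "\<And>i n. i \<in> I \<Longrightarrow> integrable M (u i n)"
    and lim: "\<And>i. i \<in> I \<Longrightarrow> (\<lambda>n. \<integral>x. \<bar>u i n x\<bar> \<partial>M) \<longlonglongrightarrow> 0"
  shows "\<exists>r::nat \<Rightarrow> nat. strict_mono r \<and> (AE x in M. \<forall>i\<in>I. (\<lambda>n. u i (r n) x) \<longlonglongrightarrow> 0)"
proof (cases "I = {}")
  case True
  then show ?thesis by (auto intro: exI[of _ id] simp: strict_mono_def)
next
  case False
  let ?i = "from_nat_into I"
  define Q where "Q k r \<longleftrightarrow> (AE x in M. (\<lambda>n. u (?i k) (r n) x) \<longlonglongrightarrow> 0)" for k and r :: "nat \<Rightarrow> nat"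
  have inI: "?i k \<in> I" for k using False by (rule from_nat_into)
  interpret subseqs Q
  proof
    fix k and s :: "nat \<Rightarrow> nat" assume s: "strict_mono s"
    have "\<exists>r. strict_mono r \<and> (AE x in M. (\<lambda>n. u (?i k) (s (r n)) x) \<longlonglongrightarrow> 0)"
      using LIMSEQ_subseq_LIMSEQ[OF lim[OF inI] s] int[OF inI]
      by (intro tendsto_L1_AE_subseq) (auto simp: o_def)
    then show "\<exists>r. strict_mono r \<and> Q k (s \<circ> r)" by (simp add: Q_def)
  qed
  have stable: "Q k (s \<circ> r)" if "strict_mono r" "Q k s" for k and r s :: "nat \<Rightarrow> nat"
    using that(2) unfolding Q_def
  proof eventually_elim
    case (elim x)
    from LIMSEQ_subseq_LIMSEQ[OF this that(1)] show ?case by (simp add: o_def)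
  qed
  obtain d where d: "strict_mono d" "\<And>k. Q k (d \<circ> ((+) (Suc k)))"
    using diagseq_holds[OF stable] subseq_diagseq by blast
  have "AE x in M. (\<lambda>n. u (?i k) (d n) x) \<longlonglongrightarrow> 0" for k
    using d(2)[of k] unfolding Q_def
  proof eventually_elim
    case (elim x)
    then have "(\<lambda>n. u (?i k) (d (n + Suc k)) x) \<longlonglongrightarrow> 0"
      by (simp add: o_def add.commute)
    then show ?case by (rule LIMSEQ_offset)
  qed
  then have "AE x in M. (\<lambda>n. u i (d n) x) \<longlonglongrightarrow> 0" if "i \<in> I" for i
    using from_nat_into_surj[OF I that] by metis
  then have "AE x in M. \<forall>i\<in>I. (\<lambda>n. u i (d n) x) \<longlonglongrightarrow> 0"
    using I by (simp add: AE_ball_countable)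
  then show ?thesis using d(1) by blast
qed

section \<open>Weak convergence from a base\<close>

text \<open>
  Inclusion and exclusion, one set at a time: \<open>X \<union> \<Union>Ys\<close> is measured by \<open>X\<close>, \<open>\<Union>Ys\<close> and
  \<open>X \<inter> \<Union>Ys = \<Union>{X \<inter> Y | Y \<in> Ys}\<close>, and the last is again a union of members of the intersection-stable
  family, as many as \<open>Ys\<close> has. The induction is therefore on the number of sets, and lists are
  used so that this number is preserved even when intersections coincide.
\<close>

lemma tendsto_measure_finite_Union:
  assumes M: "\<And>n. finite_measure (M n)" "\<And>n. sets (M n) = sets N" and N: "finite_measure N"
    and Int: "\<And>X Y. X \<in> \<A> \<Longrightarrow> Y \<in> \<A> \<Longrightarrow> X \<inter> Y \<in> \<A>" and sets: "\<A> \<subseteq> sets N"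
    and lim: "\<And>X. X \<in> \<A> \<Longrightarrow> (\<lambda>n. measure (M n) X) \<longlonglongrightarrow> measure N X"
    and Xs: "set Xs \<subseteq> \<A>"
  shows "(\<lambda>n. measure (M n) (\<Union>(set Xs))) \<longlonglongrightarrow> measure N (\<Union>(set Xs))"
  using Xs
proof (induction "length Xs" arbitrary: Xs)
  case 0
  then show ?case by simp
next
  case (Suc l)
  then obtain X Ys where Xs: "Xs = X # Ys" "l = length Ys" by (cases Xs) auto
  let ?Zs = "map ((\<inter>) X) Ys"
  have sub: "X \<in> \<A>" "set Ys \<subseteq> \<A>" "set ?Zs \<subseteq> \<A>"
    using Suc.prems Int by (auto simp: Xs)
  have meas: "X \<in> sets N" "\<Union>(set Ys) \<in> sets N"
    using sub sets by (auto intro!: sets.finite_Union)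
  have split: "measure K (\<Union>(set Xs)) = measure K X + measure K (\<Union>(set Ys)) - measure K (\<Union>(set ?Zs))"
    if "finite_measure K" "sets K = sets N" for K
  proof -
    interpret finite_measure K by fact
    have "measure K (X \<union> \<Union>(set Ys)) = measure K X + measure K (\<Union>(set Ys)) - measure K (X \<inter> \<Union>(set Ys))"
      using meas that(2) by (intro measure_Un3) (auto simp: fmeasurable_eq_sets)
    moreover have "X \<inter> \<Union>(set Ys) = \<Union>(set ?Zs)" by auto
    moreover have "\<Union>(set Xs) = X \<union> \<Union>(set Ys)" by (simp add: Xs)
    ultimately show ?thesis by (simp only:)
  qed
  have "(\<lambda>n. measure (M n) X + measure (M n) (\<Union>(set Ys)) - measure (M n) (\<Union>(set ?Zs)))
      \<longlonglongrightarrow> measure N X + measure N (\<Union>(set Ys)) - measure N (\<Union>(set ?Zs))"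
    using sub Xs by (intro tendsto_add tendsto_diff lim Suc.hyps) (auto simp del: set_map)
  then show ?case
    by (simp only: split[OF M] split[OF N refl])
qed

text \<open>
  Convergence need not survive infinite unions, but the lower bound does: the limit measure of the
  union is approached by finite unions, for which the measures converge, and the measures of the
  finite unions are below those of the whole union.
\<close>

lemma emeasure_countable_Union_le_liminf:
  assumes M: "\<And>n. finite_measure (M n)" "\<And>n. sets (M n) = sets N" and N: "finite_measure N"
    and Int: "\<And>X Y. X \<in> \<A> \<Longrightarrow> Y \<in> \<A> \<Longrightarrow> X \<inter> Y \<in> \<A>" and sets: "\<A> \<subseteq> sets N"
    and lim: "\<And>X. X \<in> \<A> \<Longrightarrow> (\<lambda>n. measure (M n) X) \<longlonglongrightarrow> measure N X"
    and \<U>: "countable \<U>" "\<U> \<subseteq> \<A>"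
  shows "emeasure N (\<Union>\<U>) \<le> liminf (\<lambda>n. emeasure (M n) (\<Union>\<U>))"
proof (cases "\<U> = {}")
  case False
  interpret N: finite_measure N by fact
  define V where "V k = \<Union>(set (map (from_nat_into \<U>) [0..<k]))" for k
  have range: "range (from_nat_into \<U>) = \<U>"
    using \<U> False by (simp add: range_from_nat_into)
  then have sub: "set (map (from_nat_into \<U>) [0..<k]) \<subseteq> \<U>" for k by auto
  have meas: "V k \<in> sets N" for k
    unfolding V_def using sub \<U> sets by (intro sets.finite_Union) blast+
  have Un: "(\<Union>k. V k) = \<Union>\<U>"
  proof
    show "(\<Union>k. V k) \<subseteq> \<Union>\<U>" unfolding V_def using sub by blast
    have "from_nat_into \<U> k \<subseteq> V (Suc k)" for k by (auto simp: V_def)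
    then show "\<Union>\<U> \<subseteq> (\<Union>k. V k)" by (subst range[symmetric]) blast
  qed
  have "incseq V" by (rule incseq_SucI) (auto simp: V_def)
  then have "(SUP k. emeasure N (V k)) = emeasure N (\<Union>\<U>)"
    using SUP_emeasure_incseq[of V N] meas Un by auto
  moreover have "emeasure N (V k) \<le> liminf (\<lambda>n. emeasure (M n) (\<Union>\<U>))" for k
  proof -
    have "(\<lambda>n. measure (M n) (V k)) \<longlonglongrightarrow> measure N (V k)"
      unfolding V_def
      by (rule tendsto_measure_finite_Union[OF M N Int sets lim]) (use sub \<U> in blast)+
    then have "(\<lambda>n. emeasure (M n) (V k)) \<longlonglongrightarrow> emeasure N (V k)"
      by (simp add: finite_measure.emeasure_eq_measure M(1) N)
    then have "emeasure N (V k) = liminf (\<lambda>n. emeasure (M n) (V k))"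
      by (simp add: lim_imp_Liminf)
    also have "\<dots> \<le> liminf (\<lambda>n. emeasure (M n) (\<Union>\<U>))"
    proof (intro Liminf_mono always_eventually allI emeasure_mono)
      show "V k \<subseteq> \<Union>\<U>" using Un by blast
      show "\<Union>\<U> \<in> sets (M n)" for n
        using \<U> sets by (auto simp: M(2) intro!: sets.countable_Union)
    qed
    finally show ?thesis .
  qed
  ultimately show ?thesis by (metis SUP_least)
qed simp

text \<open>
  The superlevel sets of \<open>g\<close> are relatively open, so the hypothesis applies at each level, and
  Fatou's lemma integrates it over the levels.
\<close>

lemma nn_integral_le_liminf_if_open:
  fixes g :: "'a::topological_space \<Rightarrow> real"
  assumes M: "\<And>n. finite_measure (M n)" "\<And>n. sets (M n) = sets (borel_on S)"
    and N: "finite_measure N" "sets N = sets (borel_on S)"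
    and lim: "\<And>U. openin (top_of_set S) U \<Longrightarrow> emeasure N U \<le> liminf (\<lambda>n. emeasure (M n) U)"
    and g: "continuous_on S g" "\<And>x. x \<in> S \<Longrightarrow> 0 \<le> g x \<and> g x \<le> b"
  shows "(\<integral>\<^sup>+x. g x \<partial>N) \<le> liminf (\<lambda>n. \<integral>\<^sup>+x. g x \<partial>M n)"
proof -
  have sp: "space N = S" "\<And>n. space (M n) = S"
    using sets_eq_imp_space_eq[OF N(2)] sets_eq_imp_space_eq[OF M(2)] by (auto simp: space_restrict_space)
  have gm: "g \<in> borel_measurable (borel_on S)"
    by (rule borel_measurable_continuous_on_restrict) fact
  have gN: "g \<in> borel_measurable N" and gM: "g \<in> borel_measurable (M n)" for n
    using gm measurable_cong_sets[OF N(2) refl] measurable_cong_sets[OF M(2) refl] by blast+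
  have op: "openin (top_of_set S) {x\<in>S. t < g x}" for t
  proof -
    have "openin (top_of_set S) (S \<inter> g -` {t<..})"
      by (rule continuous_openin_preimage_gen) (use g in auto)
    also have "S \<inter> g -` {t<..} = {x\<in>S. t < g x}" by auto
    finally show ?thesis .
  qed
  have meas: "(\<lambda>t. emeasure (M n) {x\<in>S. t < g x}) \<in> borel_measurable lborel" for n
  proof -
    interpret finite_measure "M n" by (rule M)
    have [measurable]: "g \<in> borel_measurable (M n)" by (rule gM)
    have "(\<lambda>t. emeasure (M n) {x\<in>space (M n). t < g x}) \<in> borel_measurable lborel"
      by measurable
    then show ?thesis by (simp add: sp)
  qed
  have "(\<integral>\<^sup>+x. g x \<partial>N) = (\<integral>\<^sup>+t\<in>{0..b}. emeasure N {x\<in>S. t < g x} \<partial>lborel)"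
    using nn_integral_layer_cake[OF _ gN, of b] N(1) g(2)
    by (auto simp: sp intro: finite_measure.sigma_finite_measure)
  also have "\<dots> \<le> (\<integral>\<^sup>+t\<in>{0..b}. liminf (\<lambda>n. emeasure (M n) {x\<in>S. t < g x}) \<partial>lborel)"
    by (intro nn_integral_mono mult_right_mono lim op) auto
  also have "\<dots> = (\<integral>\<^sup>+t. liminf (\<lambda>n. emeasure (M n) {x\<in>S. t < g x} * indicator {0..b} t) \<partial>lborel)"
    by (intro nn_integral_cong) (auto simp: indicator_def Liminf_const)
  also have "\<dots> \<le> liminf (\<lambda>n. \<integral>\<^sup>+t\<in>{0..b}. emeasure (M n) {x\<in>S. t < g x} \<partial>lborel)"
    by (intro nn_integral_liminf borel_measurable_times_ennreal meas) auto
  also have "\<dots> = liminf (\<lambda>n. \<integral>\<^sup>+x. g x \<partial>M n)"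
    using nn_integral_layer_cake[OF _ gM, of _ b] M(1) g(2)
    by (simp add: sp finite_measure.sigma_finite_measure)
  finally show ?thesis .
qed

text \<open>
  The direction of the portmanteau theorem that is needed here. A function bounded by \<open>b\<close> in absolute
  value gives the two nonnegative functions \<open>b + f\<close> and \<open>b - f\<close>; the lower bounds for their
  integrals are a lower and an upper bound for the integral of \<open>f\<close>.
\<close>

lemma weakly_converges_on_if_liminf_open:
  fixes M :: "nat \<Rightarrow> 'a::topological_space measure"
  assumes M: "\<And>n. prob_space (M n)" "\<And>n. sets (M n) = sets (borel_on S)"
    and N: "prob_space N" "sets N = sets (borel_on S)"
    and lim: "\<And>U. openin (top_of_set S) U \<Longrightarrow> emeasure N U \<le> liminf (\<lambda>n. emeasure (M n) U)"
  shows "weakly_converges_on S M N"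
  unfolding weakly_converges_on_def
proof (intro allI impI, elim conjE)
  fix f :: "'a \<Rightarrow> real" assume f: "continuous_on S f" "bounded (f ` S)"
  obtain b where b: "\<And>x. x \<in> S \<Longrightarrow> \<bar>f x\<bar> \<le> b"
    using f(2) by (auto simp: bounded_iff)
  have int: "integrable K f" if K: "prob_space K" "sets K = sets (borel_on S)" for K
  proof -
    interpret prob_space K by fact
    have "f \<in> borel_measurable K"
      using borel_measurable_continuous_on_restrict[OF f(1)] measurable_cong_sets[OF K(2) refl] by blast
    moreover have "space K = S"
      using sets_eq_imp_space_eq[OF K(2)] by (simp add: space_restrict_space)
    ultimately show ?thesis
      using b by (intro integrable_const_bound[of _ b]) auto
  qed
  \<comment> \<open>The sign \<open>\<sigma>\<close> treats \<open>b + f\<close> and \<open>b - f\<close> together.\<close>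
  have lower: "\<forall>\<^sub>F n in sequentially. c < \<sigma> * (\<integral>x. f x \<partial>M n)"
    if \<sigma>: "\<bar>\<sigma>\<bar> = 1" and c: "c < \<sigma> * (\<integral>x. f x \<partial>N)" for \<sigma> c :: real
  proof -
    have eq: "(\<integral>\<^sup>+x. (b + \<sigma> * f x) \<partial>K) = ennreal (b + \<sigma> * (\<integral>x. f x \<partial>K))"
      and nn: "0 \<le> b + \<sigma> * (\<integral>x. f x \<partial>K)"
      if K: "prob_space K" "sets K = sets (borel_on S)" for K
    proof -
      interpret prob_space K by fact
      have *: "space K = S"
        using sets_eq_imp_space_eq[OF K(2)] by (simp add: space_restrict_space)
      have pos: "0 \<le> b + \<sigma> * f x" if "x \<in> space K" for x
        using b[of x] \<sigma> that * by (auto simp: abs_if split: if_splits)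
      have 1: "(\<integral>x. b + \<sigma> * f x \<partial>K) = b + \<sigma> * (\<integral>x. f x \<partial>K)"
        using int[OF K] by (subst Bochner_Integration.integral_add) (auto simp: prob_space)
      show "(\<integral>\<^sup>+x. (b + \<sigma> * f x) \<partial>K) = ennreal (b + \<sigma> * (\<integral>x. f x \<partial>K))"
        using int[OF K] pos by (subst nn_integral_eq_integral) (auto simp: 1)
      have "0 \<le> (\<integral>x. b + \<sigma> * f x \<partial>K)" using pos by (intro integral_nonneg_AE) auto
      then show "0 \<le> b + \<sigma> * (\<integral>x. f x \<partial>K)" by (simp add: 1)
    qed
    have "(\<integral>\<^sup>+x. (b + \<sigma> * f x) \<partial>N) \<le> liminf (\<lambda>n. \<integral>\<^sup>+x. (b + \<sigma> * f x) \<partial>M n)"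
    proof (rule nn_integral_le_liminf_if_open[where S = S and b = "2 * b"])
      show "continuous_on S (\<lambda>x. b + \<sigma> * f x)" using f(1) by (intro continuous_intros)
      show "0 \<le> b + \<sigma> * f x \<and> b + \<sigma> * f x \<le> 2 * b" if "x \<in> S" for x
        using b[OF that] \<sigma> by (auto simp: abs_if split: if_splits)
    qed (use M N lim in \<open>auto intro: prob_space.finite_measure\<close>)
    then have le: "ennreal (b + \<sigma> * (\<integral>x. f x \<partial>N)) \<le> liminf (\<lambda>n. ennreal (b + \<sigma> * (\<integral>x. f x \<partial>M n)))"
      by (simp add: eq M N)
    \<comment> \<open>For negative \<open>b + c\<close> the truncation to \<open>ennreal\<close> loses the strict inequality, but the claim
      is then immediate.\<close>
    show ?thesis
    proof (cases "0 \<le> b + c")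
      case True
      then have "ennreal (b + c) < ennreal (b + \<sigma> * (\<integral>x. f x \<partial>N))"
        using c by (simp add: ennreal_less_iff)
      with le have "\<forall>\<^sub>F n in sequentially. ennreal (b + c) < ennreal (b + \<sigma> * (\<integral>x. f x \<partial>M n))"
        unfolding le_Liminf_iff by blast
      then show ?thesis
        by (rule eventually_mono) (use True in \<open>simp add: ennreal_less_iff\<close>)
    next
      case False
      then have "c < \<sigma> * (\<integral>x. f x \<partial>M n)" for n
        using nn[OF M(1) M(2), of n] by linarith
      then show ?thesis by simp
    qed
  qed
  show "(\<lambda>n. \<integral>x. f x \<partial>M n) \<longlonglongrightarrow> (\<integral>x. f x \<partial>N)"
  proof (rule order_tendstoI)
    fix c assume "c < (\<integral>x. f x \<partial>N)"
    then show "\<forall>\<^sub>F n in sequentially. c < (\<integral>x. f x \<partial>M n)"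
      using lower[of 1 c] by simp
  next
    fix c assume "(\<integral>x. f x \<partial>N) < c"
    then show "\<forall>\<^sub>F n in sequentially. (\<integral>x. f x \<partial>M n) < c"
      using lower[of "-1" "-c"] by simp
  qed
qed

section \<open>Convergence of the disintegrations\<close>

text \<open>
  Equicontinuity is a limit at \<open>a\<close> with \<open>a\<close> itself excluded, whereas the sequence may take the
  value \<open>a\<close>. There the oscillation vanishes, so it is continuous at \<open>a\<close> and
  can be composed with the sequence.
\<close>

lemma eventually_uniformly_le_if_equicontinuous_at:
  assumes eq: "equicontinuous_at S F a" and s: "\<And>n. s n \<in> S" "s \<longlonglongrightarrow> a" and e: "0 < e"
  shows "\<forall>\<^sub>F n in sequentially. \<forall>f\<in>F. \<bar>f (s n) - f a\<bar> \<le> e"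
proof -
  define osc where "osc t = (SUP f\<in>F. ennreal \<bar>f t - f a\<bar>)" for t
  have "osc a = 0" by (auto simp: osc_def SUP_constant bot_ennreal)
  with eq have "continuous (at a within S) osc"
    by (simp add: continuous_within equicontinuous_at_def osc_def[abs_def])
  from continuous_within_tendsto_compose[OF this _ s(2)] s(1)
  have "(\<lambda>n. osc (s n)) \<longlonglongrightarrow> osc a" by (simp add: o_def)
  then have "\<forall>\<^sub>F n in sequentially. osc (s n) < ennreal e"
    using e \<open>osc a = 0\<close> by (intro order_tendstoD) auto
  then show ?thesis
  proof eventually_elim
    case (elim n)
    show ?case
    proof
      fix f assume "f \<in> F"
      then have "ennreal \<bar>f (s n) - f a\<bar> \<le> osc (s n)" unfolding osc_def by (rule SUP_upper)
      also note elim
      finally show "\<bar>f (s n) - f a\<bar> \<le> e" using e by (simp add: ennreal_less_iff)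
    qed
  qed
qed

theorem theorem4p4:
  fixes S1 :: "'a::polish_space set" and S2 :: "'b::polish_space set" and S3 :: "'c::polish_space set"
    and P :: "'c \<Rightarrow> ('a \<times> 'b) measure" and H :: "'b \<times> 'c \<Rightarrow> 'a measure"
    and \<tau> :: "'a set set" and s3 :: 'c and s :: "nat \<Rightarrow> 'c"
  assumes "S1 \<in> sets borel" "S2 \<in> sets borel" "S3 \<in> sets borel"
    and "stochastic_kernel (S1 \<times> S2) S3 P"
    and "stochastic_kernel S1 (S2 \<times> S3) H"
    and "\<And>B C t. B \<in> sets (borel_on S1) \<Longrightarrow> C \<in> sets (borel_on S2) \<Longrightarrow> t \<in> S3 \<Longrightarrow>
           emeasure (P t) (B \<times> C) = (\<integral>\<^sup>+ s2\<in>C. emeasure (H (s2, t)) B \<partial>marginal_kernel S2 P t)"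
    and "s3 \<in> S3"
    and "countable \<tau>"
    and "openin (top_of_set S1) = arbitrary union_of (\<lambda>U. U \<in> \<tau>)"
    and "S1 \<in> \<tau>"
    and "\<And>\<O>. finite \<O> \<Longrightarrow> \<O> \<noteq> {} \<Longrightarrow> \<O> \<subseteq> \<tau> \<Longrightarrow>
           equicontinuous_at S3 {\<lambda>t. measure (P t) (\<Inter>\<O> \<times> C) | C. openin (top_of_set S2) C} s3"
    and "\<And>n. s n \<in> S3" "s \<longlonglongrightarrow> s3"
  shows "\<exists>r :: nat \<Rightarrow> nat. strict_mono r \<and>
           (\<exists>C\<in>sets (borel_on S2). measure (marginal_kernel S2 P s3) C = 1 \<and>
              (\<forall>s2\<in>C. weakly_converges_on S1 (\<lambda>k. H (s2, s (r k))) (H (s2, s3))))"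
proof -
  note P = assms(4) and H = assms(5) and disint = assms(6) and s3 = assms(7)
    and base = assms(9) and s = assms(12,13)
  define \<A> where "\<A> = Inter ` {F. finite F \<and> F \<noteq> {} \<and> F \<subseteq> \<tau>}"
  define Q where "Q = marginal_kernel S2 P"
  define h where "h X t x = measure (H (x, t)) X" for X t x

  \<comment> \<open>\<open>\<A>\<close> is countable, stable under intersection, and contains a base.\<close>
  have base_open: "openin (top_of_set S1) U" if "U \<in> \<tau>" for U
    using that by (simp add: base arbitrary_union_of_inc)
  have open_Union: "\<exists>\<U>. \<U> \<subseteq> \<tau> \<and> \<Union>\<U> = U" if "openin (top_of_set S1) U" for U
    using that unfolding base union_of_def by auto
  have "countable {F. finite F \<and> F \<subseteq> \<tau>}"
    by (rule countable_Collect_finite_subset) fact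
  then have count: "countable \<A>"
    unfolding \<A>_def by (intro countable_image) (rule countable_subset[rotated], auto)
  have \<tau>_sub: "\<tau> \<subseteq> \<A>"
  proof
    fix U assume "U \<in> \<tau>"
    then show "U \<in> \<A>" unfolding \<A>_def by (intro image_eqI[of _ _ "{U}"]) auto
  qed
  then have S1_\<A>: "S1 \<in> \<A>" using assms(10) by blast
  have \<A>_Int: "X \<inter> Y \<in> \<A>" if "X \<in> \<A>" "Y \<in> \<A>" for X Y
  proof -
    obtain F where F: "X = \<Inter>F" "finite F" "F \<noteq> {}" "F \<subseteq> \<tau>"
      using \<open>X \<in> \<A>\<close> unfolding \<A>_def by blast
    obtain G where G: "Y = \<Inter>G" "finite G" "G \<noteq> {}" "G \<subseteq> \<tau>"
      using \<open>Y \<in> \<A>\<close> unfolding \<A>_def by blast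
    from F G have "X \<inter> Y = \<Inter>(F \<union> G)" "finite (F \<union> G)" "F \<union> G \<noteq> {}" "F \<union> G \<subseteq> \<tau>" by auto
    then show ?thesis
      unfolding \<A>_def by blast
  qed
  have openin_sets: "U \<in> sets (borel_on S)" if "openin (top_of_set S) U" for U and S :: "'d::topological_space set"
    using that by (auto simp: openin_open sets_restrict_space)
  have \<A>_sets: "\<A> \<subseteq> sets (borel_on S1)"
  proof
    fix X assume "X \<in> \<A>"
    then obtain F where F: "X = \<Inter>F" "finite F" "F \<noteq> {}" "F \<subseteq> \<tau>"
      unfolding \<A>_def by blast
    then have "openin (top_of_set S1) X"
      using base_open by (simp only: F(1)) (rule openin_Inter, auto)
    then show "X \<in> sets (borel_on S1)" by (rule openin_sets)
  qed

  have H_prob: "prob_space (H (x, t))" "sets (H (x, t)) = sets (borel_on S1)"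
    if "x \<in> S2" "t \<in> S3" for x t
    using H that by (auto simp: stochastic_kernel_def)
  have P_prob: "prob_space (P t)" "space (P t) = S1 \<times> S2" if "t \<in> S3" for t
    using P that sets_eq_imp_space_eq[of "P t" "borel_on (S1 \<times> S2)"]
    by (auto simp: stochastic_kernel_def space_restrict_space)
  have Q_sets: "sets (Q t) = sets (borel_on S2)" for t
    by (simp add: Q_def marginal_kernel_def)
  have Q_space: "space (Q t) = S2" for t
    using sets_eq_imp_space_eq[OF Q_sets] by (simp add: space_restrict_space)
  have Q_eq: "emeasure (Q t) U = emeasure (P t) (S1 \<times> U)" if "t \<in> S3" "U \<in> sets (borel_on S2)" for t U
    unfolding Q_def using P that by (rule emeasure_marginal_kernel)
  have Q_prob: "prob_space (Q t)" if "t \<in> S3" for t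
  proof
    have "S2 \<in> sets (borel_on S2)" using openin_sets[of S2 S2] by simp
    then show "emeasure (Q t) (space (Q t)) = 1"
      using prob_space.emeasure_space_1[OF P_prob(1)[OF that]] that
      by (simp add: Q_eq Q_space P_prob)
  qed
  have h_meas: "h X t \<in> borel_measurable (Q t')" if "X \<in> sets (borel_on S1)" "t \<in> S3" for X t t'
  proof -
    have "(\<lambda>x. (x, t)) \<in> borel_on S2 \<rightarrow>\<^sub>M borel_on (S2 \<times> S3)"
      using that
      by (intro measurable_restrict_space3 borel_measurable_continuous_onI continuous_intros) auto
    moreover have "(\<lambda>p. measure (H p) X) \<in> borel_measurable (borel_on (S2 \<times> S3))"
      using H that by (simp add: stochastic_kernel_def)
    ultimately have "h X t \<in> borel_measurable (borel_on S2)"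
      unfolding h_def by (rule measurable_compose)
    then show ?thesis using measurable_cong_sets[OF Q_sets refl] by blast
  qed
  have h_bounds: "0 \<le> h X t x \<and> h X t x \<le> 1" if "x \<in> S2" "t \<in> S3" for X t x
    using prob_space.prob_le_1[OF H_prob(1)[OF that]] by (simp add: h_def)
  \<comment> \<open>The disintegration: \<open>U \<mapsto> P(X \<times> U | t)\<close> has density \<open>H(X | x, t)\<close> with respect to the marginal.\<close>
  have dens: "measure (density (Q t) (h X t)) U = measure (P t) (X \<times> U)"
    if X: "X \<in> sets (borel_on S1)" and U: "U \<in> sets (borel_on S2)" and t: "t \<in> S3" for X U t
  proof -
    have "emeasure (density (Q t) (h X t)) U = (\<integral>\<^sup>+x\<in>U. h X t x \<partial>Q t)"
      using h_meas[OF X t] U by (intro emeasure_density) (auto simp: Q_sets)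
    also have "\<dots> = (\<integral>\<^sup>+x\<in>U. emeasure (H (x, t)) X \<partial>Q t)"
      using H_prob(1) t
      by (intro nn_integral_cong)
        (simp add: h_def Q_space finite_measure.emeasure_eq_measure prob_space.finite_measure)
    also have "\<dots> = emeasure (P t) (X \<times> U)"
      using disint[OF X U t] by (simp add: Q_def)
    finally show ?thesis by (simp add: measure_def)
  qed

  have L1: "(\<lambda>n. \<integral>x. \<bar>h X (s n) x - h X s3 x\<bar> \<partial>Q s3) \<longlonglongrightarrow> 0" if X: "X \<in> \<A>" for X
  proof (rule tendstoI)
    fix d :: real assume d: "0 < d"
    have unif: "\<forall>\<^sub>F n in sequentially. \<forall>U. openin (top_of_set S2) U \<longrightarrow>
        \<bar>measure (P (s n)) (Y \<times> U) - measure (P s3) (Y \<times> U)\<bar> \<le> d / 5" if Y: "Y \<in> \<A>" for Y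
    proof -
      obtain F where "finite F" "F \<noteq> {}" "F \<subseteq> \<tau>" "Y = \<Inter>F" using Y unfolding \<A>_def by auto
      with assms(11) have "equicontinuous_at S3 {\<lambda>t. measure (P t) (Y \<times> C) | C. openin (top_of_set S2) C} s3"
        by blast
      from eventually_uniformly_le_if_equicontinuous_at[OF this s, of "d / 5"] d show ?thesis
        by (auto elim!: eventually_mono)
    qed
    \<comment> \<open>The set \<open>S1\<close> controls the marginals, the set \<open>X\<close> their weighted versions. The \<open>L\<^sup>1\<close> bound
      has the factor 4, so \<open>d / 5\<close> makes it strict.\<close>
    show "\<forall>\<^sub>F n in sequentially. dist (\<integral>x. \<bar>h X (s n) x - h X s3 x\<bar> \<partial>Q s3) 0 < d"
      using unif[OF S1_\<A>] unif[OF X]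
    proof eventually_elim
      case (elim n)
      have "(\<integral>x. \<bar>h X (s n) x - h X s3 x\<bar> \<partial>Q s3) \<le> 4 * (d / 5)"
      proof (rule integral_abs_diff_le_if_openin[where S = S2 and N = "Q (s n)"])
        fix U assume U: "openin (top_of_set S2) U"
        show "\<bar>measure (Q (s n)) U - measure (Q s3) U\<bar> \<le> d / 5"
          using elim(1) U Q_eq[OF s(1) openin_sets[OF U]] Q_eq[OF s3 openin_sets[OF U]]
          by (simp add: measure_def)
        show "\<bar>measure (density (Q (s n)) (h X (s n))) U - measure (density (Q s3) (h X s3)) U\<bar> \<le> d / 5"
          using elim(2) U X \<A>_sets s(1) s3 by (subst (1 2) dens) (auto intro: openin_sets)
      qed (use X \<A>_sets s(1) s3 h_meas h_bounds Q_prob Q_sets in \<open>auto intro: prob_space.finite_measure\<close>)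
      then show ?case using d by (simp add: integral_nonneg_AE)
    qed
  qed
  have int: "integrable (Q s3) (\<lambda>x. h X (s n) x - h X s3 x)" if "X \<in> \<A>" for X n
  proof -
    interpret prob_space "Q s3" by (rule Q_prob) (rule s3)
    have "integrable (Q s3) (h X t)" if "t \<in> S3" for t
      using \<open>X \<in> \<A>\<close> \<A>_sets h_meas h_bounds that
      by (intro integrable_const_bound[of _ 1]) (auto simp: Q_space)
    then show ?thesis using s(1) s3 by simp
  qed
  obtain r :: "nat \<Rightarrow> nat" where r: "strict_mono r"
    and AE: "AE x in Q s3. \<forall>X\<in>\<A>. (\<lambda>n. h X (s (r n)) x - h X s3 x) \<longlonglongrightarrow> 0"
    using AE_tendsto_subseq_countable[of \<A> "Q s3" "\<lambda>X n x. h X (s n) x - h X s3 x", OF count int L1]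
    by blast
  from AE obtain N where N: "N \<in> null_sets (Q s3)"
    and conv: "\<And>x. x \<in> S2 - N \<Longrightarrow> \<forall>X\<in>\<A>. (\<lambda>n. h X (s (r n)) x - h X s3 x) \<longlonglongrightarrow> 0"
    by (auto elim!: AE_E3 simp: Q_space)

  have "weakly_converges_on S1 (\<lambda>k. H (x, s (r k))) (H (x, s3))" if x: "x \<in> S2 - N" for x
  proof (rule weakly_converges_on_if_liminf_open)
    fix U assume "openin (top_of_set S1) U"
    then obtain \<U> where \<U>: "\<U> \<subseteq> \<tau>" "\<Union>\<U> = U" using open_Union by blast
    have "emeasure (H (x, s3)) (\<Union>\<U>) \<le> liminf (\<lambda>k. emeasure (H (x, s (r k))) (\<Union>\<U>))"
    proof (rule emeasure_countable_Union_le_liminf[where \<A> = \<A>])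
      show "(\<lambda>k. measure (H (x, s (r k))) X) \<longlonglongrightarrow> measure (H (x, s3)) X" if "X \<in> \<A>" for X
        using conv[OF x] that by (simp add: h_def LIM_zero_iff)
      show "countable \<U>" using \<U>(1) assms(8) by (rule countable_subset)
    qed (use x s(1) s3 H_prob \<A>_Int \<A>_sets \<U>(1) \<tau>_sub in \<open>auto intro: prob_space.finite_measure\<close>)
    then show "emeasure (H (x, s3)) U \<le> liminf (\<lambda>k. emeasure (H (x, s (r k))) U)"
      by (simp add: \<U>(2))
  qed (use x s(1) s3 H_prob in auto)
  moreover have "S2 - N \<in> sets (borel_on S2)"
    using N by (metis Q_sets Q_space null_setsD2 sets.compl_sets)
  moreover have "measure (Q s3) (S2 - N) = 1"
    using prob_space.prob_compl[OF Q_prob[OF s3] null_setsD2[OF N]] N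
    by (simp add: Q_space null_sets_def measure_def)
  ultimately show ?thesis
    using r unfolding Q_def by blast
qed

end
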